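(* Let $D$ be a division ring with center $Z(D)$, and let $f\colon D\to D$ be an additive map satisfying $G(x)f(x)=H(x)$ for all $x\in D$, where $G(X),H(X)\in D\{X\}$. If $G(X)\neq 0$ in $D\{X\}$, then either $D$ is finite-dimensional over $Z(D)$ or $f$ is an elementary operator.
   Context: Rings are associative with unity. $D\{X\}$ denotes the free product (coproduct) over $Z(D)$ of the $Z(D)$-algebra $D$ and the polynomial algebra $Z(D)[X]$; its elements (generalized polynomials) are finite sums of generalized monomials $a_1Xa_2X\cdots a_sXa_{s+1}$ with $a_i\in D$, where $X$ commutes with elements of $Z(D)$ but not with the other elements of $D$. For $G(X)\in D\{X\}$ and $x\in D$, $G(x)\in D$ is the value obtained by substituting $x$ for $X$. A map $f\colon D\to D$ is called an elementary operator if there exist finitely many $a_i,b_i\in D$ such that $f(x)=\sum_i a_ixb_i$ for all $x\in D$. *)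

theory Defs
  imports Complex_Main
begin

typedef (overloaded) 'a center = "{z :: 'a::division_ring. \<forall>x. z * x = x * z}"
  morphisms of_center Center
  by (rule exI[of _ 0]) simp

setup_lifting type_definition_center

instantiation center :: (division_ring) field
begin

lift_definition zero_center :: "'a center" is 0 by simp
lift_definition one_center :: "'a center" is 1 by simp
lift_definition plus_center :: "'a center \<Rightarrow> 'a center \<Rightarrow> 'a center" is "(+)"
  by (simp add: distrib_left distrib_right)
lift_definition minus_center :: "'a center \<Rightarrow> 'a center \<Rightarrow> 'a center" is "(-)"
  by (simp add: left_diff_distrib right_diff_distrib)
lift_definition uminus_center :: "'a center \<Rightarrow> 'a center" is "uminus"
  by simp
lift_definition times_center :: "'a center \<Rightarrow> 'a center \<Rightarrow> 'a center" is "(*)"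
proof -
  fix y z x :: 'a
  assume y: "\<And>x. y * x = x * y" and z: "\<And>x. z * x = x * z"
  have "y * z * x = y * (x * z)" by (simp only: mult.assoc z[of x])
  also have "\<dots> = x * (y * z)" by (simp only: mult.assoc[symmetric] y[of x])
  finally show "y * z * x = x * (y * z)" .
qed

lemma central_inverse:
  fixes z :: "'a::division_ring"
  assumes "\<forall>x. z * x = x * z"
  shows "\<forall>x. inverse z * x = x * inverse z"
proof (cases "z = 0")
  case False
  show ?thesis
  proof
    fix x
    have "inverse z * x = inverse z * (x * z) * inverse z"
      using False by (simp add: mult.assoc)
    also have "\<dots> = inverse z * (z * x) * inverse z"
      using assms by simp
    also have "\<dots> = x * inverse z"
      using False by (simp add: mult.assoc[symmetric])
    finally show "inverse z * x = x * inverse z" .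
  qed
qed simp

lift_definition inverse_center :: "'a center \<Rightarrow> 'a center" is inverse
  using central_inverse by blast
definition divide_center :: "'a center \<Rightarrow> 'a center \<Rightarrow> 'a center"
  where "divide_center a b = a * inverse b"

instance
proof
  fix a b c :: "'a center"
  show "a + b + c = a + (b + c)" by transfer (rule add.assoc)
  show "a + b = b + a" by transfer (rule add.commute)
  show "0 + a = a" by transfer (rule add_0_left)
  show "- a + a = 0" by transfer (rule left_minus)
  show "a - b = a + - b" by transfer (rule diff_conv_add_uminus)
  show "a * b * c = a * (b * c)" by transfer (rule mult.assoc)
  show "a * b = b * a" by transfer blast
  show "1 * a = a" by transfer (rule mult_1_left)
  show "(a + b) * c = a * c + b * c" by transfer (rule distrib_right)
  show "(0 :: 'a center) \<noteq> 1" by transfer simp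
  show "a \<noteq> 0 \<Longrightarrow> inverse a * a = 1" by transfer (rule left_inverse)
  show "a div b = a * inverse b" by (rule divide_center_def)
  show "inverse (0 :: 'a center) = 0" by transfer simp
qed

end

definition center_scale :: "'a::division_ring center \<Rightarrow> 'a \<Rightarrow> 'a"
  where "center_scale z x = of_center z * x"

lemma vector_space_center_scale: "vector_space center_scale"
  by unfold_locales
    (simp_all add: center_scale_def plus_center.rep_eq times_center.rep_eq one_center.rep_eq
       distrib_left distrib_right mult.assoc)

text \<open>
  The coproduct over the center of the division ring and of the polynomial algebra in one
  indeterminate over the center is constructed by generators and relations: terms built from
  constants and the indeterminate, modulo the least congruence that contains the ring axioms,
  makes \<open>GConst\<close> a unital ring homomorphism, and makes the indeterminate commute with the
  central constants. Theorem \<open>gpoly_universal\<close> is the universal property of the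
  coproduct: a homomorphism of the polynomial algebra is determined by the image of the
  indeterminate, which has to commute with the image of the center.
\<close>

datatype 'a gterm =
    GConst 'a
  | GVar
  | GAdd "'a gterm" "'a gterm"
  | GNeg "'a gterm"
  | GMul "'a gterm" "'a gterm"

inductive gcong :: "'a::division_ring gterm \<Rightarrow> 'a gterm \<Rightarrow> bool" where
  refl: "gcong p p"
| sym: "gcong p q \<Longrightarrow> gcong q p"
| trans: "gcong p q \<Longrightarrow> gcong q r \<Longrightarrow> gcong p r"
| add_cong: "gcong p p' \<Longrightarrow> gcong q q' \<Longrightarrow> gcong (GAdd p q) (GAdd p' q')"
| neg_cong: "gcong p p' \<Longrightarrow> gcong (GNeg p) (GNeg p')"
| mul_cong: "gcong p p' \<Longrightarrow> gcong q q' \<Longrightarrow> gcong (GMul p q) (GMul p' q')"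
| add_assoc: "gcong (GAdd (GAdd p q) r) (GAdd p (GAdd q r))"
| add_comm: "gcong (GAdd p q) (GAdd q p)"
| add_zero: "gcong (GAdd (GConst 0) p) p"
| add_neg: "gcong (GAdd (GNeg p) p) (GConst 0)"
| mul_assoc: "gcong (GMul (GMul p q) r) (GMul p (GMul q r))"
| one_mul: "gcong (GMul (GConst 1) p) p"
| mul_one: "gcong (GMul p (GConst 1)) p"
| distrib_right: "gcong (GMul (GAdd p q) r) (GAdd (GMul p r) (GMul q r))"
| distrib_left: "gcong (GMul p (GAdd q r)) (GAdd (GMul p q) (GMul p r))"
| const_add: "gcong (GConst (a + b)) (GAdd (GConst a) (GConst b))"
| const_mul: "gcong (GConst (a * b)) (GMul (GConst a) (GConst b))"
| var_central: "(\<And>x. z * x = x * z) \<Longrightarrow> gcong (GMul (GConst z) GVar) (GMul GVar (GConst z))"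

primrec gterm_eval :: "('a \<Rightarrow> 'b::ring_1) \<Rightarrow> 'b \<Rightarrow> 'a gterm \<Rightarrow> 'b" where
  "gterm_eval \<phi> y (GConst a) = \<phi> a"
| "gterm_eval \<phi> y GVar = y"
| "gterm_eval \<phi> y (GAdd p q) = gterm_eval \<phi> y p + gterm_eval \<phi> y q"
| "gterm_eval \<phi> y (GNeg p) = - gterm_eval \<phi> y p"
| "gterm_eval \<phi> y (GMul p q) = gterm_eval \<phi> y p * gterm_eval \<phi> y q"

definition unital_hom :: "('a::ring_1 \<Rightarrow> 'b::ring_1) \<Rightarrow> bool" where
  "unital_hom \<phi> \<longleftrightarrow>
     (\<forall>a b. \<phi> (a + b) = \<phi> a + \<phi> b) \<and> (\<forall>a b. \<phi> (a * b) = \<phi> a * \<phi> b) \<and> \<phi> 1 = 1"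

lemma unital_hom_zero: "unital_hom \<phi> \<Longrightarrow> \<phi> 0 = 0"
proof -
  assume "unital_hom \<phi>"
  then have "\<phi> (0 + 0) = \<phi> 0 + \<phi> 0"
    by (simp only: unital_hom_def)
  then show "\<phi> 0 = 0" by simp
qed

lemma unital_hom_minus: "unital_hom \<phi> \<Longrightarrow> \<phi> (- a) = - \<phi> a"
proof -
  assume \<phi>: "unital_hom \<phi>"
  then have "\<phi> (- a) + \<phi> a = \<phi> (- a + a)"
    by (simp only: unital_hom_def)
  also have "\<dots> = 0"
    using unital_hom_zero[OF \<phi>] by simp
  finally show "\<phi> (- a) = - \<phi> a"
    by (rule eq_neg_iff_add_eq_0[THEN iffD2])
qed

lemma gterm_eval_cong:
  assumes "gcong p q" "unital_hom \<phi>"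
    and "\<And>z. (\<And>x. z * x = x * z) \<Longrightarrow> \<phi> z * y = y * \<phi> z"
  shows "gterm_eval \<phi> y p = gterm_eval \<phi> y q"
  using assms(1)
proof (induction rule: gcong.induct)
  case (var_central z)
  then show ?case using assms(3)[of z] by simp
next
  case (const_add a b)
  then show ?case using assms(2) by (simp add: unital_hom_def)
next
  case (const_mul a b)
  then show ?case using assms(2) by (simp add: unital_hom_def)
qed (use assms(2) in \<open>simp_all add: unital_hom_def unital_hom_zero[OF assms(2)]
       algebra_simps\<close>)

quotient_type (overloaded) 'a gpoly = "'a::division_ring gterm" / gcong
  by (rule equivpI; rule reflpI sympI transpI; blast intro: gcong.refl gcong.sym gcong.trans)

instantiation gpoly :: (division_ring) ring_1
begin

lift_definition zero_gpoly :: "'a gpoly" is "GConst 0" .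
lift_definition one_gpoly :: "'a gpoly" is "GConst 1" .
lift_definition plus_gpoly :: "'a gpoly \<Rightarrow> 'a gpoly \<Rightarrow> 'a gpoly" is GAdd
  by (rule gcong.add_cong)
lift_definition uminus_gpoly :: "'a gpoly \<Rightarrow> 'a gpoly" is GNeg
  by (rule gcong.neg_cong)
lift_definition minus_gpoly :: "'a gpoly \<Rightarrow> 'a gpoly \<Rightarrow> 'a gpoly" is "\<lambda>p q. GAdd p (GNeg q)"
  by (intro gcong.add_cong gcong.neg_cong)
lift_definition times_gpoly :: "'a gpoly \<Rightarrow> 'a gpoly \<Rightarrow> 'a gpoly" is GMul
  by (rule gcong.mul_cong)

instance
proof
  fix a b c :: "'a gpoly"
  show "a + b + c = a + (b + c)" by transfer (rule gcong.add_assoc)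
  show "a + b = b + a" by transfer (rule gcong.add_comm)
  show "0 + a = a" by transfer (rule gcong.add_zero)
  show "- a + a = 0" by transfer (rule gcong.add_neg)
  show "a - b = a + - b" by transfer (rule gcong.refl)
  show "a * b * c = a * (b * c)" by transfer (rule gcong.mul_assoc)
  show "1 * a = a" by transfer (rule gcong.one_mul)
  show "a * 1 = a" by transfer (rule gcong.mul_one)
  show "(a + b) * c = a * c + b * c" by transfer (rule gcong.distrib_right)
  show "a * (b + c) = a * b + a * c" by transfer (rule gcong.distrib_left)
  show "(0 :: 'a gpoly) \<noteq> 1"
  proof (transfer, rule notI)
    assume "gcong (GConst (0 :: 'a)) (GConst 1)"
    then have "gterm_eval (\<lambda>a. a) 0 (GConst (0 :: 'a)) = gterm_eval (\<lambda>a. a) 0 (GConst 1)"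
      by (rule gterm_eval_cong) (simp_all add: unital_hom_def)
    then show False by simp
  qed
qed

end

lift_definition gconst :: "'a::division_ring \<Rightarrow> 'a gpoly" is GConst .
lift_definition gvar :: "'a::division_ring gpoly" is GVar .

lift_definition gpoly_eval :: "'a::division_ring gpoly \<Rightarrow> 'a \<Rightarrow> 'a"
  is "\<lambda>p x. gterm_eval (\<lambda>a. a) x p"
proof
  fix p q :: "'a gterm" and x :: 'a
  assume "gcong p q"
  then show "gterm_eval (\<lambda>a. a) x p = gterm_eval (\<lambda>a. a) x q"
    by (rule gterm_eval_cong) (simp_all add: unital_hom_def)
qed

lemma gpoly_eval_simps [simp]:
  "gpoly_eval (gconst a) x = a"
  "gpoly_eval gvar x = x"
  "gpoly_eval 0 x = 0"
  "gpoly_eval 1 x = 1"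
  "gpoly_eval (p + q) x = gpoly_eval p x + gpoly_eval q x"
  "gpoly_eval (- p) x = - gpoly_eval p x"
  "gpoly_eval (p - q) x = gpoly_eval p x - gpoly_eval q x"
  "gpoly_eval (p * q) x = gpoly_eval p x * gpoly_eval q x"
  by (transfer; simp)+

lemma unital_hom_gconst: "unital_hom gconst"
  unfolding unital_hom_def
proof (intro conjI allI)
  fix a b :: 'a
  show "gconst (a + b) = gconst a + gconst b" by transfer (rule gcong.const_add)
  show "gconst (a * b) = gconst a * gconst b" by transfer (rule gcong.const_mul)
  show "gconst (1 :: 'a) = 1" by transfer (rule gcong.refl)
qed

lemma gvar_central: "(\<And>x. z * x = x * z) \<Longrightarrow> gconst z * gvar = gvar * gconst z"
  by transfer (rule gcong.var_central)

lemma gpoly_induct [case_names const var add neg mul]: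
  assumes "\<And>a. P (gconst a)" "P gvar"
    "\<And>p q. P p \<Longrightarrow> P q \<Longrightarrow> P (p + q)" "\<And>p. P p \<Longrightarrow> P (- p)" "\<And>p q. P p \<Longrightarrow> P q \<Longrightarrow> P (p * q)"
  shows "P (p :: 'a::division_ring gpoly)"
proof -
  have "P (abs_gpoly t)" for t
  proof (induction t)
    case (GConst a) show ?case using assms(1)[of a] by (simp only: gconst.abs_eq)
  next
    case GVar show ?case using assms(2) by (simp only: gvar.abs_eq)
  next
    case (GAdd t u) from assms(3)[OF this] show ?case by (simp only: plus_gpoly.abs_eq)
  next
    case (GNeg t) from assms(4)[OF this] show ?case by (simp only: uminus_gpoly.abs_eq)
  next
    case (GMul t u) from assms(5)[OF this] show ?case by (simp only: times_gpoly.abs_eq)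
  qed
  from this[of "rep_gpoly p"] show ?thesis
    by (simp only: Quotient_abs_rep[OF Quotient_gpoly])
qed

theorem gpoly_universal:
  fixes \<phi> :: "'a::division_ring \<Rightarrow> 'b::ring_1" and y :: 'b
  assumes "unital_hom \<phi>" and "\<And>z. (\<And>x. z * x = x * z) \<Longrightarrow> \<phi> z * y = y * \<phi> z"
  shows "\<exists>!\<Phi>. unital_hom \<Phi> \<and> (\<forall>a. \<Phi> (gconst a) = \<phi> a) \<and> \<Phi> gvar = y"
proof (rule ex_ex1I)
  define \<Phi> where "\<Phi> p = gterm_eval \<phi> y (rep_gpoly p)" for p
  have abs: "\<Phi> (abs_gpoly t) = gterm_eval \<phi> y t" for t
    unfolding \<Phi>_def using Quotient_rep_abs[OF Quotient_gpoly gcong.refl] assms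
    by (rule gterm_eval_cong)
  have ex: "\<exists>t. p = abs_gpoly t" for p :: "'a gpoly"
    by (rule exI[of _ "rep_gpoly p"]) (simp only: Quotient_abs_rep[OF Quotient_gpoly])
  have "\<Phi> (p + q) = \<Phi> p + \<Phi> q" "\<Phi> (p * q) = \<Phi> p * \<Phi> q" for p q
    using ex[of p] ex[of q] by (auto simp: plus_gpoly.abs_eq times_gpoly.abs_eq abs)
  moreover have "\<Phi> 1 = 1"
    using assms(1) by (simp add: one_gpoly.abs_eq abs unital_hom_def)
  ultimately have "unital_hom \<Phi>"
    by (simp add: unital_hom_def)
  then show "\<exists>\<Phi>. unital_hom \<Phi> \<and> (\<forall>a. \<Phi> (gconst a) = \<phi> a) \<and> \<Phi> gvar = y"
    by (intro exI[of _ \<Phi>]) (simp add: gconst.abs_eq gvar.abs_eq abs)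
next
  fix \<Phi> \<Psi> :: "'a gpoly \<Rightarrow> 'b"
  assume \<Phi>: "unital_hom \<Phi> \<and> (\<forall>a. \<Phi> (gconst a) = \<phi> a) \<and> \<Phi> gvar = y"
    and \<Psi>: "unital_hom \<Psi> \<and> (\<forall>a. \<Psi> (gconst a) = \<phi> a) \<and> \<Psi> gvar = y"
  show "\<Phi> = \<Psi>"
  proof
    fix p show "\<Phi> p = \<Psi> p"
    proof (induction p rule: gpoly_induct)
      case (neg p)
      then show ?case using \<Phi> \<Psi> by (simp add: unital_hom_minus)
    qed (use \<Phi> \<Psi> in \<open>simp_all add: unital_hom_def\<close>)
  qed
qed

definition elementary_operator :: "('a::ring_1 \<Rightarrow> 'a) \<Rightarrow> bool" where
  "elementary_operator f \<longleftrightarrow> (\<exists>(n::nat) a b. \<forall>x. f x = (\<Sum>i<n. a i * x * b i))"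

end

theory Submission
  imports Defs "HOL-Combinatorics.Multiset_Permutations"
begin

text \<open>
  Suppose \<open>D\<close> has infinite dimension over its center \<open>Z\<close>. Polarizing
  \<open>G(x) f(x) = H(x)\<close> turns it into an identity in which every variable occurs once in
  each term. If \<open>G\<close> has degree \<open>m\<close> with leading form \<open>G\<^sub>m\<close>, the polarized left-hand side in the
  variables \<open>y\<^sub>0, \<dots>, y\<^sub>m\<close> is the sum over \<open>v\<close> of \<open>P\<^sub>v f(y\<^sub>v)\<close>, where \<open>P\<^sub>v\<close> is the polarization of
  \<open>G\<^sub>m\<close> in the variables other than \<open>y\<^sub>v\<close>; lower forms have too few letters to contribute. Now fix
  \<open>y\<^sub>1, \<dots>, y\<^sub>m\<close> and let \<open>y\<^sub>0 = x\<close> vary. The term with \<open>v = 0\<close> is a constant times \<open>f(x)\<close>. In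
  all the others \<open>x\<close> occurs once and outside \<open>f\<close>, so they are elementary operators in \<open>x\<close>, and so
  is the right-hand side once the degree of \<open>H\<close> is known to be at most \<open>m + 1\<close>. Hence \<open>f\<close> is
  elementary as soon as the constant can be made nonzero, that is, as soon as the
  polarization of \<open>G\<^sub>m\<close> is not the zero function. The bound on the degree of \<open>H\<close> has the same
  source: if it failed, polarizing in as many variables as that degree would leave nothing
  on the left and the polarized leading form of \<open>H\<close> on the right.

  Everything thus rests on \<open>polarization_nonzero\<close>: over an infinite-dimensional \<open>D\<close>, a nonzero
  homogeneous generalized polynomial has a polarization that does not vanish identically.
  This is a multilinear form of the theorem of Amitsur on generalized polynomial identities. The
  polarization is a sum over the orderings of the variables, and the crucial point is that the
  parts belonging to different orderings cannot cancel (\<open>words_separate\<close>). It is enough to treat two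
  variables \<open>x\<close>, \<open>y\<close> and to show that terms \<open>a x b y c\<close> cannot cancel against terms \<open>a' y b' x c'\<close>
  (\<open>separate_orders\<close>). For fixed \<open>x\<close>, a cancellation forces the left factors \<open>a x b\<close>, suitably
  collected, into the span of the finitely many \<open>a'\<close>; thus the elementary operators formed from
  them have finite rank. A commutator argument (\<open>finite_rank_coeffs_zero\<close>) shows that a
  nonzero elementary operator of finite rank exists only if \<open>D\<close> is finite-dimensional. Once the
  orderings are separated, a single one determines the generalized polynomial, by stripping off
  one letter at a time (\<open>monomials_zero_if_word_zero\<close>).

  The argument uses no scalars from \<open>Z\<close> to separate homogeneous components, so it covers finite
  centers and positive characteristic as well.
\<close>

section \<open>Elementary operators of finite rank\<close>

interpretation cs: vector_space "center_scale :: 'a::division_ring center \<Rightarrow> 'a \<Rightarrow> 'a"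
  by (rule vector_space_center_scale)

lemma of_center_commute: "of_center z * x = x * of_center z"
  using of_center[of z] by blast

lemma center_scale_mult_left: "center_scale z a * x = center_scale z (a * x)"
  by (simp add: center_scale_def mult.assoc)

lemma center_scale_mult_right: "a * center_scale z x = center_scale z (a * x)"
  unfolding center_scale_def by (metis mult.assoc of_center_commute)

lemma span_mult_right: "v \<in> cs.span S \<Longrightarrow> v * d \<in> cs.span ((\<lambda>s. s * d) ` S)"
proof (induction rule: cs.span_induct_alt)
  case base
  show ?case by (simp add: cs.span_zero)
next
  case (step z s v)
  then show ?case
    by (auto simp: semiring_class.distrib_right center_scale_mult_left
        intro: cs.span_add cs.span_scale cs.span_base)
qed

lemma span_mult_left: "v \<in> cs.span S \<Longrightarrow> d * v \<in> cs.span ((\<lambda>s. d * s) ` S)"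
proof (induction rule: cs.span_induct_alt)
  case base
  show ?case by (simp add: cs.span_zero)
next
  case (step z s v)
  then show ?case
    by (auto simp: semiring_class.distrib_left center_scale_mult_right
        intro: cs.span_add cs.span_scale cs.span_base)
qed

text \<open>
  Central coefficients slide past any factor. Expanding all left (or all right) factors of an
  elementary operator in one basis, and moving the coefficients to the other side, therefore gives
  a form with linearly independent left (or right) factors.
\<close>

lemma finite_basis_expansion:
  fixes a :: "'i \<Rightarrow> 'a::division_ring"
  assumes "finite I"
  obtains B k where "finite B" "cs.independent B"
    "\<And>i. i \<in> I \<Longrightarrow> a i = (\<Sum>b\<in>B. center_scale (k i b) b)"
proof -
  obtain B where B: "B \<subseteq> a ` I" "cs.independent B" "a ` I \<subseteq> cs.span B"
    using cs.maximal_independent_subset[of "a ` I"] by blast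
  have fin: "finite B" using B(1) assms finite_subset by blast
  show ?thesis
  proof (rule that[OF fin B(2), of "\<lambda>i. cs.representation B (a i)"])
    fix i assume "i \<in> I"
    then show "a i = (\<Sum>b\<in>B. center_scale (cs.representation B (a i) b) b)"
      using B fin by (subst cs.sum_representation_eq) auto
  qed
qed

lemma regroup_left:
  assumes "\<And>i. i \<in> I \<Longrightarrow> a i = (\<Sum>b\<in>B. center_scale (k i b) b)"
  shows "(\<Sum>i\<in>I. a i * x * c i) = (\<Sum>b\<in>B. b * x * (\<Sum>i\<in>I. center_scale (k i b) (c i)))"
proof -
  have "(\<Sum>i\<in>I. a i * x * c i) = (\<Sum>i\<in>I. \<Sum>b\<in>B. center_scale (k i b) (b * x * c i))"
    using assms by (simp add: sum_distrib_right center_scale_mult_left)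
  also have "\<dots> = (\<Sum>b\<in>B. \<Sum>i\<in>I. center_scale (k i b) (b * x * c i))"
    by (rule sum.swap)
  finally show ?thesis
    by (simp add: sum_distrib_left center_scale_mult_right)
qed

lemma regroup_right:
  assumes "\<And>i. i \<in> I \<Longrightarrow> c i = (\<Sum>b\<in>B. center_scale (k i b) b)"
  shows "(\<Sum>i\<in>I. a i * x * c i) = (\<Sum>b\<in>B. (\<Sum>i\<in>I. center_scale (k i b) (a i)) * x * b)"
proof -
  have "(\<Sum>i\<in>I. a i * x * c i) = (\<Sum>i\<in>I. \<Sum>b\<in>B. center_scale (k i b) (a i * x * b))"
    using assms by (simp add: sum_distrib_left center_scale_mult_right)
  also have "\<dots> = (\<Sum>b\<in>B. \<Sum>i\<in>I. center_scale (k i b) (a i * x * b))"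
    by (rule sum.swap)
  finally show ?thesis
    by (simp add: sum_distrib_right center_scale_mult_left)
qed

text \<open>
  The parameter serves only to name the division ring whose dimension over its center is infinite.
\<close>

locale infinite_over_center =
  fixes D :: "'a::division_ring itself"
  assumes infinite_dim: "finite (S :: 'a set) \<Longrightarrow> cs.span S \<noteq> UNIV"
begin

text \<open>
  Induction on the number of terms. Scale on the right so that one coefficient becomes \<open>1\<close>,
  giving an operator \<open>F\<close>. Then \<open>F(y d) - F(y) d\<close> replaces each coefficient \<open>q\<close> by the commutator
  \<open>d q - q d\<close>; it has finite rank and one term less, since \<open>1\<close> commutes with \<open>d\<close>. By induction all
  coefficients are central, so \<open>F\<close> is left multiplication by an element that is nonzero by
  independence. Such a map is bijective, and its finite rank contradicts infinite dimension.
  The rank zero case says that the coefficients of such an operator are determined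
  by its values.
\<close>

lemma finite_rank_coeffs_zero:
  fixes B S :: "'a set"
  assumes "finite B" "cs.independent B" "finite S"
    and "\<And>y. (\<Sum>b\<in>B. b * y * r b) \<in> cs.span S" and "b \<in> B"
  shows "r b = 0"
  using assms
proof (induction B arbitrary: r S b rule: finite_psubset_induct)
  case (psubset B r S b\<^sub>0)
  show ?case
  proof (rule ccontr)
    assume nz: "r b\<^sub>0 \<noteq> 0"
    note b0 = psubset.prems(4)
    define q where "q b = r b * inverse (r b\<^sub>0)" for b
    define S' where "S' = (\<lambda>s. s * inverse (r b\<^sub>0)) ` S"
    define F where "F y = (\<Sum>b\<in>B. b * y * q b)" for y
    have F: "F y \<in> cs.span S'" for y
      using span_mult_right[OF psubset.prems(3)[of y], of "inverse (r b\<^sub>0)"]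
      by (simp add: F_def q_def S'_def sum_distrib_right mult.assoc)
    have q0: "q b\<^sub>0 = 1" using nz by (simp add: q_def)
    have comm: "d * q b = q b * d" if "b \<in> B" for b d
    proof (cases "b = b\<^sub>0")
      case True
      then show ?thesis by (simp add: q0)
    next
      case False
      have "d * q b - q b * d = 0"
      proof (rule psubset.IH[where B = "B - {b\<^sub>0}" and r = "\<lambda>b. d * q b - q b * d" and b = b])
        show "B - {b\<^sub>0} \<subset> B" using b0 by blast
        show "cs.independent (B - {b\<^sub>0})"
          using psubset.prems(1) cs.independent_mono by blast
        show "finite (S' \<union> (\<lambda>s. s * d) ` S')"
          using psubset.prems(2) by (simp add: S'_def)
        show "b \<in> B - {b\<^sub>0}" using that False by simp
        fix y
        have "F (y * d) - F y * d = (\<Sum>b\<in>B. b * y * (d * q b - q b * d))"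
          by (simp add: F_def sum_distrib_right right_diff_distrib sum_subtractf mult.assoc)
        also have "\<dots> = (\<Sum>b\<in>B - {b\<^sub>0}. b * y * (d * q b - q b * d))"
          using psubset.hyps b0 by (simp add: sum.remove q0)
        finally have "(\<Sum>b\<in>B - {b\<^sub>0}. b * y * (d * q b - q b * d)) = F (y * d) - F y * d" ..
        moreover have "F (y * d) \<in> cs.span (S' \<union> (\<lambda>s. s * d) ` S')"
          using F cs.span_mono[of S' "S' \<union> (\<lambda>s. s * d) ` S'"] by blast
        moreover have "F y * d \<in> cs.span (S' \<union> (\<lambda>s. s * d) ` S')"
          using span_mult_right[OF F[of y], of d]
            cs.span_mono[of "(\<lambda>s. s * d) ` S'" "S' \<union> (\<lambda>s. s * d) ` S'"] by blast
        ultimately show "(\<Sum>b\<in>B - {b\<^sub>0}. b * y * (d * q b - q b * d))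
            \<in> cs.span (S' \<union> (\<lambda>s. s * d) ` S')"
          by (simp add: cs.span_diff)
      qed
      then show ?thesis by simp
    qed
    \<comment> \<open>All coefficients being central, \<open>F\<close> is left multiplication by \<open>e\<close>.\<close>
    define z where "z b = Center (q b)" for b
    have z: "of_center (z b) = q b" if "b \<in> B" for b
      unfolding z_def using comm[OF that] by (intro Center_inverse) auto
    define e where "e = (\<Sum>b\<in>B. center_scale (z b) b)"
    have "e \<noteq> 0"
    proof
      assume "e = 0"
      then have "z b\<^sub>0 = 0"
        using cs.independentD[OF psubset.prems(1) psubset.hyps order_refl, of z] b0
        by (simp add: e_def)
      then show False using z[OF b0] q0 by (simp add: zero_center.rep_eq)
    qed
    have Fe: "F y = e * y" for y
      unfolding F_def e_def sum_distrib_right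
    proof (rule sum.cong)
      fix b assume b: "b \<in> B"
      show "b * y * q b = center_scale (z b) b * y"
        using comm[OF b, of "b * y"] by (simp add: center_scale_def z[OF b] mult.assoc)
    qed simp
    have "y \<in> cs.span ((\<lambda>s. inverse e * s) ` S')" for y
      using span_mult_left[OF F, of "inverse e" y] \<open>e \<noteq> 0\<close>
      by (simp add: Fe mult.assoc[symmetric])
    moreover have "finite ((\<lambda>s. inverse e * s) ` S')"
      using psubset.prems(2) by (simp add: S'_def)
    ultimately show False using infinite_dim by blast
  qed
qed

lemma finite_rank_elementary_zero:
  fixes a c :: "'i \<Rightarrow> 'a"
  assumes "finite I" "finite S" and "\<And>x. (\<Sum>i\<in>I. a i * x * c i) \<in> cs.span S"
  shows "(\<Sum>i\<in>I. a i * x * c i) = 0"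
proof -
  obtain B k where B: "finite B" "cs.independent B"
    and k: "\<And>i. i \<in> I \<Longrightarrow> a i = (\<Sum>b\<in>B. center_scale (k i b) b)"
    using finite_basis_expansion[OF assms(1)] by metis
  note eq = regroup_left[where I = I, OF k]
  have "(\<Sum>i\<in>I. center_scale (k i b) (c i)) = 0" if "b \<in> B" for b
    by (rule finite_rank_coeffs_zero[OF B assms(2) _ that]) (use assms(3) eq in simp)
  then show ?thesis by (simp add: eq)
qed

text \<open>
  Extend a basis \<open>U\<close> of the span of the \<open>a j\<close> to a basis \<open>B\<close> that also expands the \<open>p c\<close>, and
  compare the coefficients standing to the right of an element of \<open>B\<close> outside \<open>U\<close>: the right-hand
  side has none, so those of the \<open>p c\<close> vanish by independence of \<open>C\<close>.
\<close>

lemma left_factors_in_span: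
  fixes a q :: "'j \<Rightarrow> 'a"
  assumes "finite C" "cs.independent C" "finite J"
    and eq: "\<And>y. (\<Sum>c\<in>C. p c * y * c) = (\<Sum>j\<in>J. a j * y * q j)" and "c \<in> C"
  shows "p c \<in> cs.span (a ` J)"
proof -
  obtain U where U: "U \<subseteq> a ` J" "cs.independent U" "a ` J \<subseteq> cs.span U"
    using cs.maximal_independent_subset[of "a ` J"] by blast
  obtain B where B: "U \<subseteq> B" "B \<subseteq> U \<union> p ` C" "cs.independent B" "U \<union> p ` C \<subseteq> cs.span B"
    using cs.maximal_independent_subset_extend[of U "U \<union> p ` C"] U(2) by blast
  have "finite U" using U(1) assms(3) finite_subset by blast
  then have finB: "finite B" using B(2) assms(1) finite_subset by blast
  define k where "k = cs.representation B"
  have expand: "v = (\<Sum>b\<in>B. center_scale (k v b) b)" if "v \<in> cs.span B" for v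
    using cs.sum_representation_eq[OF B(3) that finB] by (simp add: k_def)
  have pB: "p c \<in> cs.span B" if "c \<in> C" for c
    using B(4) that by blast
  have aU: "a j \<in> cs.span U" if "j \<in> J" for j
    using U(3) that by blast
  then have aB: "a j \<in> cs.span B" if "j \<in> J" for j
    using that cs.span_mono[OF B(1)] by blast
  define R where "R b = (\<Sum>c\<in>C. center_scale (k (p c) b) c) - (\<Sum>j\<in>J. center_scale (k (a j) b) (q j))" for b
  have "(\<Sum>b\<in>B. b * y * R b) = 0" for y
  proof -
    have "(\<Sum>b\<in>B. b * y * R b) = (\<Sum>c\<in>C. p c * y * c) - (\<Sum>j\<in>J. a j * y * q j)"
      using regroup_left[where I = C and c = "\<lambda>c. c" and x = y, OF expand[OF pB]]
        regroup_left[where I = J and c = q and x = y, OF expand[OF aB]]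
      by (simp add: R_def right_diff_distrib sum_subtractf)
    then show ?thesis using eq by simp
  qed
  then have R: "R b = 0" if "b \<in> B" for b
    using finite_rank_coeffs_zero[OF finB B(3), of "{}" R] that by simp
  \<comment> \<open>Outside \<open>U\<close> the terms \<open>a j\<close> have coordinate zero, so only those of the \<open>p c\<close> remain.\<close>
  have zero: "k (p c) b = 0" if "b \<in> B - U" for b
  proof -
    have "k (a j) b = 0" if "j \<in> J" for j
      unfolding k_def cs.representation_extend[OF B(3) aU[OF that] B(1)]
      using \<open>b \<in> B - U\<close> cs.representation_ne_zero by blast
    then have "(\<Sum>c\<in>C. center_scale (k (p c) b) c) = 0"
      using R[of b] that by (simp add: R_def)
    then show ?thesis
      using cs.independentD[OF assms(2,1) order_refl, of "\<lambda>c. k (p c) b"] assms(5) by simp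
  qed
  have "(\<Sum>b\<in>B. center_scale (k (p c) b) b) \<in> cs.span (a ` J)"
  proof (rule cs.span_sum)
    fix b assume "b \<in> B"
    show "center_scale (k (p c) b) b \<in> cs.span (a ` J)"
    proof (cases "b \<in> U")
      case True
      then show ?thesis using U(1) by (intro cs.span_scale cs.span_base) blast
    next
      case False
      then show ?thesis using zero[of b] \<open>b \<in> B\<close> by (simp add: cs.span_zero)
    qed
  qed
  then show ?thesis using expand[OF pB[OF assms(5)]] by simp
qed

text \<open>
  Collect the terms with \<open>x\<close> first as a sum of \<open>\<phi> e x * y * e\<close> with independent right factors \<open>e\<close>.
  For each fixed \<open>x\<close> the terms with \<open>y\<close> first have left factors \<open>a' j\<close>, which do not depend on \<open>x\<close>;
  so all values \<open>\<phi> e x\<close> lie in one finite-dimensional space and the operators \<open>\<phi> e\<close> vanish.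
\<close>

lemma separate_orders:
  fixes a b c :: "'i \<Rightarrow> 'a" and a' b' c' :: "'j \<Rightarrow> 'a"
  assumes "finite I" "finite J"
    and eq: "\<And>x y. (\<Sum>i\<in>I. a i * x * b i * y * c i) + (\<Sum>j\<in>J. a' j * y * b' j * x * c' j) = 0"
  shows "(\<Sum>i\<in>I. a i * x * b i * y * c i) = 0"
proof -
  obtain C k where C: "finite C" "cs.independent C"
    and k: "\<And>i. i \<in> I \<Longrightarrow> c i = (\<Sum>e\<in>C. center_scale (k i e) e)"
    using finite_basis_expansion[OF assms(1)] by metis
  define \<phi> where "\<phi> e x = (\<Sum>i\<in>I. center_scale (k i e) (a i) * x * b i)" for e x
  have A: "(\<Sum>i\<in>I. a i * x * b i * y * c i) = (\<Sum>e\<in>C. \<phi> e x * y * e)" for x y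
    using regroup_right[where I = I and a = "\<lambda>i. a i * x * b i" and x = y, OF k]
    by (simp add: \<phi>_def center_scale_mult_left)
  have "\<phi> e x \<in> cs.span (a' ` J)" if "e \<in> C" for e x
  proof (rule left_factors_in_span[OF C assms(2) _ that])
    fix y
    have "(\<Sum>j\<in>J. a' j * y * - (b' j * x * c' j)) = - (\<Sum>j\<in>J. a' j * y * b' j * x * c' j)"
      by (simp add: sum_negf mult.assoc)
    with eq[of x y] show "(\<Sum>e\<in>C. \<phi> e x * y * e) = (\<Sum>j\<in>J. a' j * y * - (b' j * x * c' j))"
      by (simp add: A add_eq_0_iff2)
  qed
  then have "\<phi> e x = 0" if "e \<in> C" for e x
    unfolding \<phi>_def using finite_rank_elementary_zero[OF assms(1), of "a' ` J"] assms(2) that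
    by (simp add: \<phi>_def)
  then show ?thesis by (simp add: A)
qed

end

section \<open>Generalized monomials and words\<close>

lemma gconst_simps:
  fixes a b :: "'a::division_ring"
  shows "gconst (0 :: 'a) = 0" "gconst (1 :: 'a) = 1" "gconst (a + b) = gconst a + gconst b"
    "gconst (a * b) = gconst a * gconst b"
  using unital_hom_gconst[where 'a = 'a] unital_hom_zero[OF unital_hom_gconst[where 'a = 'a]]
  by (simp_all add: unital_hom_def)

lemma gconst_sum: "gconst (\<Sum>i\<in>I. a i) = (\<Sum>i\<in>I. gconst (a i))"
  by (induction I rule: infinite_finite_induct) (simp_all add: gconst_simps)

lemma gpoly_eval_sum: "gpoly_eval (\<Sum>i\<in>I. p i) x = (\<Sum>i\<in>I. gpoly_eval (p i) x)"
  by (induction I rule: infinite_finite_induct) simp_all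

text \<open>
  The list \<open>[a\<^sub>0, \<dots>, a\<^sub>k]\<close> stands for the generalized monomial \<open>a\<^sub>0 X a\<^sub>1 X \<dots> X a\<^sub>k\<close> of degree \<open>k\<close>. The
  value at the empty list, which stands for no monomial, is chosen to agree with \<open>word_eval\<close> below.
\<close>

fun gmonom :: "'a::division_ring list \<Rightarrow> 'a gpoly" where
  "gmonom [] = 0"
| "gmonom [a] = gconst a"
| "gmonom (a # b # as) = gconst a * gvar * gmonom (b # as)"

lemma gmonom_Cons: "as \<noteq> [] \<Longrightarrow> gmonom (a # as) = gconst a * gvar * gmonom as"
  by (cases as) simp_all

text \<open>
  A generalized monomial has one slot for each occurrence of \<open>X\<close>; a word \<open>w\<close> fills these slots with
  the variables \<open>y v\<close> for the letters \<open>v\<close> of \<open>w\<close>, giving \<open>a\<^sub>0 (y w\<^sub>1) a\<^sub>1 \<dots> (y w\<^sub>k) a\<^sub>k\<close>. A word too long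
  for its monomial gives \<open>0\<close>, so that factorizations along a word need no condition on lengths.
\<close>

fun word_eval :: "'a::division_ring list \<Rightarrow> nat list \<Rightarrow> (nat \<Rightarrow> 'a) \<Rightarrow> 'a" where
  "word_eval [] w y = 0"
| "word_eval (a # as) [] y = a"
| "word_eval (a # as) (v # w) y = a * y v * word_eval as w y"

lemma word_eval_cong: "(\<And>v. v \<in> set w \<Longrightarrow> y v = y' v) \<Longrightarrow> word_eval as w y = word_eval as w y'"
  by (induction as w y rule: word_eval.induct) simp_all

definition scale_head :: "'a::division_ring center \<Rightarrow> 'a list \<Rightarrow> 'a list" where
  "scale_head z as = (case as of [] \<Rightarrow> [] | a # as' \<Rightarrow> center_scale z a # as')"

lemma length_scale_head [simp]: "length (scale_head z as) = length as"
  by (simp add: scale_head_def split: list.split)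

lemma word_eval_scale_head: "word_eval (scale_head z as) w y = center_scale z (word_eval as w y)"
  by (cases as; cases w) (simp_all add: scale_head_def center_scale_mult_left)

lemma gmonom_scale_head: "gmonom (scale_head z as) = gconst (of_center z) * gmonom as"
  by (cases as rule: gmonom.cases)
    (simp_all add: scale_head_def center_scale_def gconst_simps mult.assoc)

lemma gvar_of_center: "gconst (of_center z) * gvar = gvar * gconst (of_center z)"
  by (rule gvar_central) (rule of_center_commute)

context infinite_over_center
begin

text \<open>
  Induction on the word. Once the leading coefficients are expanded in a basis, the first letter,
  which does not recur, ranges freely over \<open>D\<close> and isolates the factor to the right
  of each basis element; that factor belongs to the same kind of sum for the shorter word.
  In the ring of generalized polynomials the same rearrangement is possible because \<open>X\<close> commutes
  with central constants.
\<close>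

lemma monomials_zero_if_word_zero:
  fixes M :: "'i \<Rightarrow> 'a list"
  assumes "finite I" "distinct w" "\<And>i. i \<in> I \<Longrightarrow> length (M i) = Suc (length w)"
    and "\<And>y. (\<Sum>i\<in>I. word_eval (M i) w y) = 0"
  shows "(\<Sum>i\<in>I. gmonom (M i)) = 0"
  using assms
proof (induction w arbitrary: M)
  case Nil
  have "M i = [hd (M i)]" if "i \<in> I" for i
    using Nil.prems(3)[OF that] by (cases "M i") simp_all
  then have M: "gmonom (M i) = gconst (word_eval (M i) [] y)" if "i \<in> I" for i y
    using that by (metis gmonom.simps(2) word_eval.simps(2))
  have "(\<Sum>i\<in>I. gmonom (M i)) = gconst (\<Sum>i\<in>I. word_eval (M i) [] (\<lambda>_. 0))"
    unfolding gconst_sum using M by (intro sum.cong) auto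
  then show ?case using Nil.prems(4) by (simp add: gconst_simps)
next
  case (Cons v w)
  define h where "h i = hd (M i)" for i
  define t where "t i = tl (M i)" for i
  have M: "M i = h i # t i" and len: "length (t i) = Suc (length w)" if "i \<in> I" for i
    using Cons.prems(3)[OF that] by (cases "M i"; simp add: h_def t_def)+
  obtain B k where B: "finite B" "cs.independent B"
    and k: "\<And>i. i \<in> I \<Longrightarrow> h i = (\<Sum>b\<in>B. center_scale (k i b) b)"
    using finite_basis_expansion[OF Cons.prems(1)] by metis
  have part: "(\<Sum>i\<in>I. gmonom (scale_head (k i b) (t i))) = 0" if b: "b \<in> B" for b
  proof (rule Cons.IH)
    show "finite I" "distinct w" using Cons.prems by simp_all
    show "length (scale_head (k i b) (t i)) = Suc (length w)" if "i \<in> I" for i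
      using len[OF that] by simp
    fix y
    have "(\<Sum>b\<in>B. b * x * (\<Sum>i\<in>I. center_scale (k i b) (word_eval (t i) w y))) = 0" for x
    proof -
      have "(\<Sum>b\<in>B. b * x * (\<Sum>i\<in>I. center_scale (k i b) (word_eval (t i) w y)))
          = (\<Sum>i\<in>I. h i * x * word_eval (t i) w y)"
        by (rule regroup_left[OF k, symmetric])
      also have "\<dots> = (\<Sum>i\<in>I. word_eval (M i) (v # w) (y(v := x)))"
        using Cons.prems(2) by (intro sum.cong) (auto simp: M intro!: word_eval_cong)
      finally show ?thesis using Cons.prems(4) by simp
    qed
    then show "(\<Sum>i\<in>I. word_eval (scale_head (k i b) (t i)) w y) = 0"
      using finite_rank_coeffs_zero[OF B, of "{}" "\<lambda>b. \<Sum>i\<in>I. center_scale (k i b) (word_eval (t i) w y)"] b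
      by (simp add: word_eval_scale_head)
  qed
  have "(\<Sum>i\<in>I. gmonom (M i)) = (\<Sum>i\<in>I. gconst (h i) * gvar * gmonom (t i))"
  proof (rule sum.cong)
    fix i assume i: "i \<in> I"
    have "t i \<noteq> []" using len[OF i] by auto
    then show "gmonom (M i) = gconst (h i) * gvar * gmonom (t i)"
      by (simp add: M[OF i] gmonom_Cons)
  qed simp
  also have "\<dots> = (\<Sum>i\<in>I. \<Sum>b\<in>B. gconst b * gvar * gmonom (scale_head (k i b) (t i)))"
  proof (rule sum.cong)
    fix i assume i: "i \<in> I"
    have "gconst (center_scale z b) * gvar * p = gconst b * gvar * (gconst (of_center z) * p)"
      for z and b :: 'a and p
    proof -
      have "center_scale z b = b * of_center z"
        by (simp add: center_scale_def of_center_commute)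
      then show ?thesis
        using gvar_of_center[of z] by (simp add: gconst_simps mult.assoc)
    qed
    then show "gconst (h i) * gvar * gmonom (t i)
        = (\<Sum>b\<in>B. gconst b * gvar * gmonom (scale_head (k i b) (t i)))"
      by (simp add: k[OF i] gconst_sum sum_distrib_right gmonom_scale_head)
  qed simp
  also have "\<dots> = (\<Sum>b\<in>B. \<Sum>i\<in>I. gconst b * gvar * gmonom (scale_head (k i b) (t i)))"
    by (rule sum.swap)
  also have "\<dots> = (\<Sum>b\<in>B. gconst b * gvar * (\<Sum>i\<in>I. gmonom (scale_head (k i b) (t i))))"
    by (simp add: sum_distrib_left)
  finally show ?case by (simp add: part)
qed

end

section \<open>Separating the words of a multilinear identity\<close>

lemma word_eval_append:
  "\<exists>l bs. \<forall>y'. (\<forall>v\<in>set p. y' v = y v) \<longrightarrow> word_eval as (p @ w) y' = l * word_eval bs w y'"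
proof (induction p arbitrary: as)
  case Nil
  show ?case by (rule exI[of _ 1], rule exI[of _ as]) simp
next
  case (Cons v p)
  show ?case
  proof (cases as)
    case Nil
    then show ?thesis by (auto intro!: exI[of _ 0])
  next
    case (Cons a as')
    obtain l bs where "\<forall>y'. (\<forall>v\<in>set p. y' v = y v) \<longrightarrow> word_eval as' (p @ w) y' = l * word_eval bs w y'"
      using Cons.IH by blast
    then show ?thesis
      by (intro exI[of _ "a * y v * l"] exI[of _ bs]) (simp add: Cons mult.assoc)
  qed
qed

lemma word_eval_one_letter:
  "\<exists>l r. \<forall>y'. (\<forall>t\<in>set p \<union> set q. y' t = y t) \<longrightarrow> word_eval as (p @ u # q) y' = l * y' u * r"
proof -
  obtain l bs where l: "\<And>y'. (\<forall>v\<in>set p. y' v = y v) \<Longrightarrow>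
      word_eval as (p @ u # q) y' = l * word_eval bs (u # q) y'"
    using word_eval_append[of p y as "u # q"] by blast
  show ?thesis
  proof (cases bs)
    case Nil
    then show ?thesis using l by (intro exI[of _ 0]) simp
  next
    case (Cons b bs')
    show ?thesis
    proof (intro exI allI impI)
      fix y' assume y': "\<forall>t\<in>set p \<union> set q. y' t = y t"
      then show "word_eval as (p @ u # q) y' = (l * b) * y' u * word_eval bs' q y"
        using l[of y'] word_eval_cong[of q y' y bs'] by (simp add: Cons mult.assoc)
    qed
  qed
qed

lemma word_eval_two_letters:
  "\<exists>a b c. \<forall>y'. (\<forall>t\<in>set p \<union> set q \<union> set r. y' t = y t) \<longrightarrow>
     word_eval as (p @ u # q @ v # r) y' = a * y' u * b * y' v * c"
proof -
  obtain l bs where l: "\<And>y'. (\<forall>v\<in>set p. y' v = y v) \<Longrightarrow>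
      word_eval as (p @ u # q @ v # r) y' = l * word_eval bs (u # q @ v # r) y'"
    using word_eval_append[of p y as "u # q @ v # r"] by blast
  show ?thesis
  proof (cases bs)
    case Nil
    then show ?thesis using l by (intro exI[of _ 0]) simp
  next
    case (Cons b bs')
    obtain l' c where l': "\<And>y'. (\<forall>t\<in>set q \<union> set r. y' t = y t) \<Longrightarrow>
        word_eval bs' (q @ v # r) y' = l' * y' v * c"
      using word_eval_one_letter[of q r y bs' v] by blast
    show ?thesis
    proof (intro exI allI impI)
      fix y' assume y': "\<forall>t\<in>set p \<union> set q \<union> set r. y' t = y t"
      then show "word_eval as (p @ u # q @ v # r) y' = (l * b) * y' u * l' * y' v * c"
        using l[of y'] l'[of y'] by (simp add: Cons mult.assoc)
    qed
  qed
qed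

text \<open>
  On distinct words this says that \<open>u\<close> stands somewhere to the left of \<open>v\<close>.
\<close>

fun before :: "'v \<Rightarrow> 'v \<Rightarrow> 'v list \<Rightarrow> bool" where
  "before u v [] \<longleftrightarrow> False"
| "before u v (x # w) \<longleftrightarrow> x = u \<and> v \<in> set w \<or> before u v w"

lemma before_in_set: "before u v w \<Longrightarrow> u \<in> set w \<and> v \<in> set w"
  by (induction w) auto

lemma before_total: "u \<in> set w \<Longrightarrow> v \<in> set w \<Longrightarrow> u \<noteq> v \<Longrightarrow> before u v w \<or> before v u w"
  by (induction w) auto

lemma before_asym: "distinct w \<Longrightarrow> before u v w \<Longrightarrow> \<not> before v u w"
  by (induction w) (auto dest: before_in_set)

lemma before_split: "before u v w \<Longrightarrow> \<exists>p q r. w = p @ u # q @ v # r"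
proof (induction w)
  case (Cons x w)
  show ?case
  proof (cases "before u v w")
    case True
    then obtain p q r where "w = p @ u # q @ v # r" using Cons.IH by blast
    then have "x # w = (x # p) @ u # q @ v # r" by simp
    then show ?thesis by blast
  next
    case False
    then obtain q r where "x = u" "w = q @ v # r"
      using Cons.prems by (auto dest: split_list)
    then have "x # w = [] @ u # q @ v # r" by simp
    then show ?thesis by blast
  qed
qed simp

text \<open>
  Past the longest common prefix, the two first letters form such a pair.
\<close>

lemma differently_ordered_pair:
  assumes "distinct w" "distinct w'" "set w = set w'" "w \<noteq> w'"
  shows "\<exists>u v. before u v w \<and> before v u w'"
  using assms
proof (induction w arbitrary: w')
  case (Cons x w)
  then obtain x' v where w': "w' = x' # v" by (cases w') auto
  show ?case
  proof (cases "x = x'")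
    case True
    then have "set w = set v" using Cons.prems w' by auto
    then obtain a b where "before a b w \<and> before b a v"
      using Cons.IH[of v] Cons.prems w' True by auto
    then show ?thesis using w' by auto
  next
    case False
    then have "x' \<in> set w" "x \<in> set v" using Cons.prems w' by auto
    then show ?thesis using w' by auto
  qed
qed simp

lemma word_eval_before:
  assumes "distinct w" "before u v w"
  shows "\<exists>a b c. \<forall>x z. word_eval as w (y(u := x, v := z)) = a * x * b * z * c"
proof -
  obtain p q r where w: "w = p @ u # q @ v # r" using before_split[OF assms(2)] by blast
  obtain a b c where "\<And>y'. (\<forall>t\<in>set p \<union> set q \<union> set r. y' t = y t) \<Longrightarrow>
      word_eval as w y' = a * y' u * b * y' v * c"
    using word_eval_two_letters[of p q r y as u v] unfolding w by blast
  moreover have "u \<noteq> v" "\<forall>t\<in>set p \<union> set q \<union> set r. (y(u := x, v := z)) t = y t" for x z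
    using assms(1) unfolding w by auto
  ultimately have "word_eval as w (y(u := x, v := z)) = a * x * b * z * c" for x z
    by (metis fun_upd_same fun_upd_other)
  then show ?thesis by blast
qed

context infinite_over_center
begin

text \<open>
  Two different words order some pair \<open>u\<close>, \<open>v\<close> differently. As functions of \<open>y u\<close> and \<open>y v\<close>, the
  words with \<open>u\<close> first and those with \<open>v\<close> first contribute terms of the two shapes of
  \<open>separate_orders\<close>, so both partial sums vanish, and the set of words can be made smaller
  until a single one is left.
\<close>

lemma words_separate:
  fixes M :: "'i \<Rightarrow> 'a list"
  assumes "finite W" "finite I" "\<And>w. w \<in> W \<Longrightarrow> distinct w \<and> set w = V"
    and "\<And>y. (\<Sum>i\<in>I. \<Sum>w\<in>W. word_eval (M i) w y) = 0" and "w \<in> W"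
  shows "(\<Sum>i\<in>I. word_eval (M i) w y) = 0"
  using assms
proof (induction W arbitrary: y rule: finite_psubset_induct)
  case (psubset W)
  show ?case
  proof (cases "W = {w}")
    case True
    then show ?thesis using psubset.prems(3) by simp
  next
    case False
    then obtain w' where w': "w' \<in> W" "w' \<noteq> w" using psubset.prems(4) by blast
    have "set w = set w'" using psubset.prems(2,4) w'(1) by metis
    then obtain u v where uv: "before u v w" "before v u w'"
      using differently_ordered_pair[of w w'] psubset.prems(2,4) w' by metis
    have "u \<noteq> v" using before_asym[of w u v] uv(1) psubset.prems(2,4) by blast
    define W\<^sub>1 where "W\<^sub>1 = {w\<in>W. before u v w}"
    define W\<^sub>2 where "W\<^sub>2 = W - W\<^sub>1"
    have fin: "finite W\<^sub>1" "finite W\<^sub>2" using psubset.hyps by (simp_all add: W\<^sub>1_def W\<^sub>2_def)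
    have dist1: "distinct w" if "w \<in> W\<^sub>1" for w
      using that psubset.prems(2) unfolding W\<^sub>1_def by blast
    have dist2: "distinct w" if "w \<in> W\<^sub>2" for w
      using that psubset.prems(2) unfolding W\<^sub>2_def by blast
    have before2: "before v u w" if "w \<in> W\<^sub>2" for w
    proof -
      have "u \<in> set w" "v \<in> set w"
        using before_in_set[OF uv(1)] that psubset.prems(2,4) unfolding W\<^sub>2_def by blast+
      then show ?thesis
        using before_total[of u w v] that \<open>u \<noteq> v\<close> unfolding W\<^sub>1_def W\<^sub>2_def by blast
    qed
    have zero: "(\<Sum>i\<in>I. \<Sum>w\<in>W\<^sub>1. word_eval (M i) w y) = 0" for y
    proof -
      have "\<exists>a b c. \<forall>x z. word_eval (M (fst s)) (snd s) (y(u := x, v := z)) = a * x * b * z * c"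
        if "s \<in> I \<times> W\<^sub>1" for s
        by (rule word_eval_before) (use that dist1 in \<open>auto simp: W\<^sub>1_def\<close>)
      then obtain a b c where 1: "\<And>s x z. s \<in> I \<times> W\<^sub>1 \<Longrightarrow>
          word_eval (M (fst s)) (snd s) (y(u := x, v := z)) = a s * x * b s * z * c s"
        by metis
      have "\<exists>a b c. \<forall>z x. word_eval (M (fst s)) (snd s) (y(v := z, u := x)) = a * z * b * x * c"
        if "s \<in> I \<times> W\<^sub>2" for s
        by (rule word_eval_before) (use that dist2 before2 in auto)
      then obtain a' b' c' where 2: "\<And>s x z. s \<in> I \<times> W\<^sub>2 \<Longrightarrow>
          word_eval (M (fst s)) (snd s) (y(u := x, v := z)) = a' s * z * b' s * x * c' s"
        unfolding fun_upd_twist[OF \<open>u \<noteq> v\<close>] by metis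
      have sum1: "(\<Sum>i\<in>I. \<Sum>w\<in>W\<^sub>1. word_eval (M i) w (y(u := x, v := z)))
          = (\<Sum>s\<in>I \<times> W\<^sub>1. a s * x * b s * z * c s)" for x z
        unfolding sum.cartesian_product using 1 by (intro sum.cong) auto
      have sum2: "(\<Sum>i\<in>I. \<Sum>w\<in>W\<^sub>2. word_eval (M i) w (y(u := x, v := z)))
          = (\<Sum>s\<in>I \<times> W\<^sub>2. a' s * z * b' s * x * c' s)" for x z
        unfolding sum.cartesian_product using 2 by (intro sum.cong) auto
      have split: "(\<Sum>w\<in>W. g w) = (\<Sum>w\<in>W\<^sub>1. g w) + (\<Sum>w\<in>W\<^sub>2. g w)" for g :: "nat list \<Rightarrow> 'a"
        unfolding W\<^sub>2_def using psubset.hyps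
        by (subst sum.subset_diff[of W\<^sub>1 W]) (auto simp: W\<^sub>1_def add.commute)
      have "(\<Sum>s\<in>I \<times> W\<^sub>1. a s * x * b s * z * c s) + (\<Sum>s\<in>I \<times> W\<^sub>2. a' s * z * b' s * x * c' s) = 0" for x z
        using psubset.prems(3)[of "y(u := x, v := z)"]
        by (simp only: split sum.distrib sum1 sum2)
      then have "(\<Sum>s\<in>I \<times> W\<^sub>1. a s * x * b s * z * c s) = 0" for x z
        using separate_orders[of "I \<times> W\<^sub>1" "I \<times> W\<^sub>2" a b c a' b' c'] fin assms(2) by blast
      then show ?thesis
        using sum1[of "y u" "y v"] by simp
    qed
    show ?thesis
    proof (rule psubset.IH[of W\<^sub>1])
      have "w' \<notin> W\<^sub>1"
        using before_asym[OF _ uv(2)] w'(1) psubset.prems(2) by (auto simp: W\<^sub>1_def)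
      then show "W\<^sub>1 \<subset> W" using w'(1) by (auto simp: W\<^sub>1_def)
      show "w \<in> W\<^sub>1" using psubset.prems(4) uv(1) by (simp add: W\<^sub>1_def)
      show "w \<in> W\<^sub>1 \<Longrightarrow> distinct w \<and> set w = V" for w
        using psubset.prems(2) by (simp add: W\<^sub>1_def)
    qed (use zero assms(2) in auto)
  qed
qed

lemma polarization_nonzero:
  fixes M :: "'i \<Rightarrow> 'a list"
  assumes "finite I" "finite V" "\<And>i. i \<in> I \<Longrightarrow> length (M i) = Suc (card V)"
    and "(\<Sum>i\<in>I. gmonom (M i)) \<noteq> 0"
  shows "\<exists>y. (\<Sum>i\<in>I. \<Sum>w\<in>permutations_of_set V. word_eval (M i) w y) \<noteq> 0"
proof (rule ccontr)
  assume "\<not> ?thesis"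
  then have zero: "(\<Sum>i\<in>I. \<Sum>w\<in>permutations_of_set V. word_eval (M i) w y) = 0" for y
    by blast
  obtain w where w: "w \<in> permutations_of_set V"
    using assms(2) permutations_of_set_empty_iff[of V] by blast
  have perm: "distinct w \<and> set w = V" if "w \<in> permutations_of_set V" for w
    using that by (simp add: permutations_of_set_def)
  have "(\<Sum>i\<in>I. word_eval (M i) w y) = 0" for y
    by (rule words_separate[OF _ assms(1) perm zero w]) simp
  moreover have "length w = card V" using perm[OF w] distinct_card[of w] by simp
  ultimately have "(\<Sum>i\<in>I. gmonom (M i)) = 0"
    using monomials_zero_if_word_zero[OF assms(1), of w M] perm[OF w] assms(3) by simp
  then show False using assms(4) by simp
qed

end

section \<open>Polarization\<close>

lemma sum_split_support:
  fixes h :: "'x \<Rightarrow> 'b::comm_monoid_add" and g :: "'x \<Rightarrow> 'v set"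
  assumes "finite V" "finite X"
  shows "(\<Sum>x\<in>{x\<in>X. g x \<subseteq> V}. h x)
    = (\<Sum>x\<in>{x\<in>X. g x = V}. h x) + (\<Sum>S\<in>Pow V - {V}. \<Sum>x\<in>{x\<in>X. g x = S}. h x)"
proof -
  have "(\<Sum>x\<in>{x\<in>X. g x \<subseteq> V}. h x) = (\<Sum>S\<in>Pow V. \<Sum>x\<in>{x\<in>{x\<in>X. g x \<subseteq> V}. g x = S}. h x)"
    using assms by (intro sum.group[symmetric]) auto
  also have "\<dots> = (\<Sum>S\<in>Pow V. \<Sum>x\<in>{x\<in>X. g x = S}. h x)"
    by (intro sum.cong) auto
  finally show ?thesis
    using assms(1) by (simp add: sum.remove[of "Pow V" V])
qed

text \<open>
  A form of Moebius inversion over subsets: equality of the sums over all terms supported inside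
  \<open>S\<close>, for every \<open>S\<close>, gives equality of the sums over terms supported exactly on \<open>V\<close>. Extracting the terms that
  involve all variables in this way is polarization without alternating signs.
\<close>

lemma sums_over_supports_eq:
  fixes P :: "'s \<Rightarrow> 'b::ab_group_add" and Q :: "'t \<Rightarrow> 'b"
    and p :: "'s \<Rightarrow> 'v set" and q :: "'t \<Rightarrow> 'v set"
  assumes "finite V" "finite A" "finite B"
    and "\<And>S. S \<subseteq> V \<Longrightarrow> (\<Sum>s\<in>{s\<in>A. p s \<subseteq> S}. P s) = (\<Sum>t\<in>{t\<in>B. q t \<subseteq> S}. Q t)"
  shows "(\<Sum>s\<in>{s\<in>A. p s = V}. P s) = (\<Sum>t\<in>{t\<in>B. q t = V}. Q t)"
  using assms(1,4)
proof (induction V rule: finite_psubset_induct)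
  case (psubset V)
  have "(\<Sum>s\<in>{s\<in>A. p s = S}. P s) = (\<Sum>t\<in>{t\<in>B. q t = S}. Q t)" if "S \<in> Pow V - {V}" for S
  proof (rule psubset.IH)
    show "S \<subset> V" using that by blast
    fix S' assume "S' \<subseteq> S"
    then show "(\<Sum>s\<in>{s\<in>A. p s \<subseteq> S'}. P s) = (\<Sum>t\<in>{t\<in>B. q t \<subseteq> S'}. Q t)"
      using that by (intro psubset.prems) auto
  qed
  then have "(\<Sum>S\<in>Pow V - {V}. \<Sum>s\<in>{s\<in>A. p s = S}. P s)
      = (\<Sum>S\<in>Pow V - {V}. \<Sum>t\<in>{t\<in>B. q t = S}. Q t)"
    by (intro sum.cong) auto
  then show ?case
    using psubset.prems[of V] sum_split_support[OF psubset.hyps assms(2), of P p]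
      sum_split_support[OF psubset.hyps assms(3), of Q q] by simp
qed

definition words :: "nat set \<Rightarrow> nat \<Rightarrow> nat list set" where
  "words S n = {w. set w \<subseteq> S \<and> length w = n}"

lemma finite_words: "finite S \<Longrightarrow> finite (words S n)"
  unfolding words_def by (rule finite_lists_length_eq)

lemma gmonom_eval_sum:
  assumes "finite S"
  shows "gpoly_eval (gmonom as) (\<Sum>v\<in>S. y v) = (\<Sum>w\<in>words S (length as - 1). word_eval as w y)"
proof (induction as rule: gmonom.induct)
  case (2 a)
  have "words S 0 = {[]}" by (auto simp: words_def)
  then show ?case by simp
next
  case (3 a b as)
  have "words S (Suc (length as)) = (\<lambda>(w, v). v # w) ` (words S (length as) \<times> S)"
    unfolding words_def by (rule lists_length_Suc_eq)
  then have "(\<Sum>w\<in>words S (Suc (length as)). word_eval (a # b # as) w y)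
      = (\<Sum>(w, v)\<in>words S (length as) \<times> S. a * y v * word_eval (b # as) w y)"
    by (simp add: sum.reindex inj_on_def case_prod_unfold)
  also have "\<dots> = (\<Sum>w\<in>words S (length as). \<Sum>v\<in>S. a * y v * word_eval (b # as) w y)"
    by (rule sum.cartesian_product[symmetric])
  also have "\<dots> = a * (\<Sum>v\<in>S. y v) * (\<Sum>w\<in>words S (length as). word_eval (b # as) w y)"
    by (simp add: sum_distrib_left sum_distrib_right mult.assoc)
  finally show ?case using 3 by simp
qed simp

text \<open>
  Substitute \<open>x = (\<Sum>v\<in>S. y v)\<close> for every \<open>S \<subseteq> V\<close> and expand both sides into words over \<open>S\<close>. Additivity
  of \<open>f\<close> makes \<open>f (y v)\<close> behave like one further letter, so a term on the left has support
  \<open>insert v (set w)\<close>.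
\<close>

lemma polarized_identity:
  fixes M :: "'i \<Rightarrow> 'a::division_ring list" and N :: "'j \<Rightarrow> 'a list"
  assumes "finite I" "finite J" "finite V" "additive f"
    and eq: "\<And>x. gpoly_eval (\<Sum>i\<in>I. gmonom (M i)) x * f x = gpoly_eval (\<Sum>j\<in>J. gmonom (N j)) x"
  shows "(\<Sum>(i, w, v)\<in>{(i, w, v)\<in>(SIGMA i:I. words V (length (M i) - 1) \<times> V). insert v (set w) = V}.
            word_eval (M i) w y * f (y v))
       = (\<Sum>(j, w)\<in>{(j, w)\<in>(SIGMA j:J. words V (length (N j) - 1)). set w = V}. word_eval (N j) w y)"
proof -
  define A where "A S = (SIGMA i:I. words S (length (M i) - 1) \<times> S)" for S
  define B where "B S = (SIGMA j:J. words S (length (N j) - 1))" for S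
  define p where "p = (\<lambda>(i::'i, w::nat list, v::nat). insert v (set w))"
  define q where "q = (\<lambda>(j::'j, w::nat list). set w)"
  define P where "P = (\<lambda>(i, w, v). word_eval (M i) w y * f (y v))"
  define Q where "Q = (\<lambda>(j, w). word_eval (N j) w y)"
  have "(\<Sum>s\<in>{s\<in>A V. p s = V}. P s) = (\<Sum>t\<in>{t\<in>B V. q t = V}. Q t)"
  proof (rule sums_over_supports_eq)
    show "finite V" by fact
    then show "finite (A V)" "finite (B V)"
      using assms(1,2) by (auto simp: A_def B_def finite_words)
    fix S assume S: "S \<subseteq> V"
    then have finS: "finite S" using assms(3) finite_subset by blast
    have "{s\<in>A V. p s \<subseteq> S} = A S" "{t\<in>B V. q t \<subseteq> S} = B S"
      using S by (auto simp: A_def B_def p_def q_def words_def)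
    moreover have "(\<Sum>s\<in>A S. P s) = gpoly_eval (\<Sum>i\<in>I. gmonom (M i)) (\<Sum>v\<in>S. y v) * f (\<Sum>v\<in>S. y v)"
    proof -
      have "(\<Sum>s\<in>A S. P s) = (\<Sum>i\<in>I. \<Sum>w\<in>words S (length (M i) - 1). \<Sum>v\<in>S. word_eval (M i) w y * f (y v))"
        unfolding A_def P_def using assms(1) finS
        by (simp add: sum.Sigma[symmetric] finite_words sum.cartesian_product[symmetric])
      then show ?thesis
        by (simp only: gpoly_eval_sum gmonom_eval_sum[OF finS] additive.sum[OF assms(4)]
            sum_distrib_right) (simp only: sum_distrib_left)
    qed
    moreover have "(\<Sum>t\<in>B S. Q t) = gpoly_eval (\<Sum>j\<in>J. gmonom (N j)) (\<Sum>v\<in>S. y v)"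
      unfolding B_def Q_def using assms(2) finS
      by (simp add: sum.Sigma[symmetric] finite_words gpoly_eval_sum gmonom_eval_sum)
    ultimately show "(\<Sum>s\<in>{s\<in>A V. p s \<subseteq> S}. P s) = (\<Sum>t\<in>{t\<in>B V. q t \<subseteq> S}. Q t)"
      using eq by simp
  qed
  moreover have "{(i, w, v)\<in>A V. insert v (set w) = V} = {s\<in>A V. p s = V}"
    "{(j, w)\<in>B V. set w = V} = {t\<in>B V. q t = V}"
    by (auto simp: p_def q_def)
  ultimately show ?thesis
    by (simp only: A_def B_def P_def Q_def)
qed

section \<open>Elementary operators\<close>

lemma elementary_operator_sum_index:
  assumes "finite I"
  shows "elementary_operator (\<lambda>x. \<Sum>i\<in>I. a i * x * b i)"
proof -
  obtain h where "bij_betw h {0..<card I} I"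
    using ex_bij_betw_nat_finite[OF assms] by blast
  then have h: "bij_betw h {..<card I} I" by (simp add: atLeast0LessThan)
  show ?thesis
    unfolding elementary_operator_def
    by (intro exI[of _ "card I"] exI[of _ "a \<circ> h"] exI[of _ "b \<circ> h"])
      (simp add: sum.reindex_bij_betw[OF h, of "\<lambda>i. a i * _ * b i"])
qed

lemma elementary_operator_sum:
  assumes "finite S" "\<And>s. s \<in> S \<Longrightarrow> elementary_operator (g s)"
  shows "elementary_operator (\<lambda>x. \<Sum>s\<in>S. g s x)"
proof -
  obtain n :: "_ \<Rightarrow> nat" and a b where g: "\<And>s x. s \<in> S \<Longrightarrow> g s x = (\<Sum>i<n s. a s i * x * b s i)"
    using assms(2) unfolding elementary_operator_def by metis
  have "(\<Sum>s\<in>S. g s x) = (\<Sum>(s, i)\<in>(SIGMA s:S. {..<n s}). a s i * x * b s i)" for x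
    using assms(1) g by (simp add: sum.Sigma[symmetric])
  then show ?thesis
    using elementary_operator_sum_index[of "SIGMA s:S. {..<n s}" "\<lambda>(s, i). a s i" "\<lambda>(s, i). b s i"] assms(1)
    by (simp add: case_prod_unfold)
qed

lemma elementary_operator_diff:
  assumes "elementary_operator g" "elementary_operator h"
  shows "elementary_operator (\<lambda>x. g x - h x)"
proof -
  have "elementary_operator (\<lambda>x. - h x)"
  proof -
    obtain n a b where "\<And>x. h x = (\<Sum>i<n::nat. a i * x * b i)"
      using assms(2) unfolding elementary_operator_def by blast
    then show ?thesis
      unfolding elementary_operator_def
      by (intro exI[of _ n] exI[of _ "\<lambda>i. - a i"] exI[of _ b]) (simp add: sum_negf)
  qed
  then have "elementary_operator (\<lambda>x. \<Sum>s\<in>UNIV. (if s then g x else - h x))"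
  proof (intro elementary_operator_sum)
    show "elementary_operator (\<lambda>x. if s then g x else - h x)" if "elementary_operator (\<lambda>x. - h x)" for s
      using that assms(1) by (cases s) auto
  qed simp
  then show ?thesis by (simp add: UNIV_bool)
qed

lemma elementary_operator_mult_left:
  assumes "elementary_operator g"
  shows "elementary_operator (\<lambda>x. c * g x)"
proof -
  obtain n a b where "\<And>x. g x = (\<Sum>i<n::nat. a i * x * b i)"
    using assms unfolding elementary_operator_def by blast
  then show ?thesis
    unfolding elementary_operator_def
    by (intro exI[of _ n] exI[of _ "\<lambda>i. c * a i"] exI[of _ b]) (simp add: sum_distrib_left mult.assoc)
qed

lemma elementary_operator_word_eval:
  assumes "distinct w" "u \<in> set w"
  shows "elementary_operator (\<lambda>x. word_eval as w (y(u := x)) * c)"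
proof -
  obtain p q where w: "w = p @ u # q" using assms(2) split_list by metis
  obtain l r where lr: "\<And>y'. (\<forall>t\<in>set p \<union> set q. y' t = y t) \<Longrightarrow> word_eval as w y' = l * y' u * r"
    using word_eval_one_letter[of p q y as u] unfolding w by blast
  have "word_eval as w (y(u := x)) * c = l * x * (r * c)" for x
    using lr[of "y(u := x)"] assms(1) unfolding w by (auto simp: mult.assoc)
  then show ?thesis
    using elementary_operator_sum_index[of "{()}" "\<lambda>_. l" "\<lambda>_. r * c"] by simp
qed

section \<open>Generalized polynomials as sums of monomials\<close>

lemma gmonom_mult: "gmonom (as @ [a]) * gmonom (b # bs) = gmonom (as @ (a * b) # bs)"
proof (induction as)
  case Nil
  show ?case by (cases bs) (simp_all add: gconst_simps mult.assoc)
next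
  case (Cons c as)
  then show ?case by (simp add: gmonom_Cons mult.assoc)
qed

lemma gpoly_sum_list_gmonom:
  fixes p :: "'a::division_ring gpoly"
  shows "\<exists>ms. [] \<notin> set ms \<and> p = sum_list (map gmonom ms)"
proof -
  define R :: "'a gpoly \<Rightarrow> bool" where "R p \<longleftrightarrow> (\<exists>ms. [] \<notin> set ms \<and> p = sum_list (map gmonom ms))" for p
  have mono: "R (gmonom m)" if "m \<noteq> []" for m
    unfolding R_def using that by (intro exI[of _ "[m]"]) auto
  have zero: "R 0" unfolding R_def by (intro exI[of _ "[]"]) simp
  have add: "R (p + q)" if Rs: "R p" "R q" for p q
  proof -
    obtain ms ns where "[] \<notin> set ms" "p = sum_list (map gmonom ms)" "[] \<notin> set ns" "q = sum_list (map gmonom ns)"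
      using Rs unfolding R_def by blast
    then show ?thesis unfolding R_def by (intro exI[of _ "ms @ ns"]) simp
  qed
  have mono_mult: "R (gmonom m * gmonom n)" if "m \<noteq> []" "n \<noteq> []" for m n
  proof -
    obtain as a where m: "m = as @ [a]" using \<open>m \<noteq> []\<close> by (cases m rule: rev_cases) auto
    obtain b bs where n: "n = b # bs" using \<open>n \<noteq> []\<close> by (cases n) auto
    show ?thesis unfolding m n gmonom_mult by (rule mono) simp
  qed
  have mono_mult_list: "[] \<notin> set ns \<Longrightarrow> m \<noteq> [] \<Longrightarrow> R (gmonom m * sum_list (map gmonom ns))" for m ns
    by (induction ns) (auto simp: zero semiring_class.distrib_left intro: add mono_mult)
  have mult: "R (p * q)" if Rs: "R p" "R q" for p q
  proof -
    obtain ns where ns: "[] \<notin> set ns" "q = sum_list (map gmonom ns)"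
      using Rs unfolding R_def by blast
    have "[] \<notin> set ms \<Longrightarrow> R (sum_list (map gmonom ms) * q)" for ms
      by (induction ms)
        (auto simp: ns(2) zero semiring_class.distrib_right intro!: add mono_mult_list[OF ns(1)])
    then show ?thesis using Rs(1) unfolding R_def by blast
  qed
  have const: "R (gconst a)" for a using mono[of "[a]"] by simp
  have "R p"
  proof (induction p rule: gpoly_induct)
    case var
    show ?case using mono[of "[1, 1]"] by (simp add: gconst_simps)
  next
    case (neg p)
    have "gconst (- 1) = (- 1 :: 'a gpoly)"
      using unital_hom_minus[OF unital_hom_gconst, of 1] by (simp add: gconst_simps)
    then show ?case using mult[OF const[of "- 1"] neg] by simp
  qed (use const add mult in auto)
  then show ?thesis by (simp add: R_def)
qed

text \<open>
  A representation by monomials need not be unique, and its top-degree monomials may cancel. One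
  whose longest monomial is as short as possible has a nonzero leading form, since a vanishing
  one could be deleted.
\<close>

lemma gpoly_leading_form:
  fixes p :: "'a::division_ring gpoly"
  assumes "p \<noteq> 0"
  shows "\<exists>n (I::nat set) M. finite I \<and> p = (\<Sum>i\<in>I. gmonom (M i))
    \<and> (\<forall>i\<in>I. M i \<noteq> [] \<and> length (M i) \<le> Suc n)
    \<and> (\<Sum>i\<in>{i\<in>I. length (M i) = Suc n}. gmonom (M i)) \<noteq> 0"
proof -
  define bounded where "bounded n \<longleftrightarrow> (\<exists>(I::nat set) M. finite I \<and> p = (\<Sum>i\<in>I. gmonom (M i)) \<and>
      (\<forall>i\<in>I. M i \<noteq> [] \<and> length (M i) \<le> n))" for n
  obtain ms where ms: "[] \<notin> set ms" "p = sum_list (map gmonom ms)"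
    using gpoly_sum_list_gmonom by blast
  have "bounded (Max (length ` set ms))"
    unfolding bounded_def
  proof (intro exI conjI ballI)
    show "p = (\<Sum>i\<in>{..<length ms}. gmonom (ms ! i))"
      by (simp add: ms(2) sum_list_sum_nth atLeast0LessThan)
    show "ms ! i \<noteq> []" if "i \<in> {..<length ms}" for i
      using ms(1) that by (metis lessThan_iff nth_mem)
    show "length (ms ! i) \<le> Max (length ` set ms)" if "i \<in> {..<length ms}" for i
      using that by simp
  qed simp
  then have least: "bounded (LEAST n. bounded n)" by (rule LeastI)
  moreover have "\<not> bounded 0" using assms by (auto simp: bounded_def)
  ultimately obtain n where n: "(LEAST n. bounded n) = Suc n" by (metis not0_implies_Suc)
  obtain I :: "nat set" and M where I: "finite I" "p = (\<Sum>i\<in>I. gmonom (M i))"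
    "\<forall>i\<in>I. M i \<noteq> [] \<and> length (M i) \<le> Suc n"
    using least[unfolded n] unfolding bounded_def by (elim exE conjE) (rule that)
  have "(\<Sum>i\<in>{i\<in>I. length (M i) = Suc n}. gmonom (M i)) \<noteq> 0"
  proof
    assume zero: "(\<Sum>i\<in>{i\<in>I. length (M i) = Suc n}. gmonom (M i)) = 0"
    have "p = (\<Sum>i\<in>I - {i\<in>I. length (M i) = Suc n}. gmonom (M i))"
      using I(1) zero unfolding I(2) by (subst sum.subset_diff[of "{i\<in>I. length (M i) = Suc n}" I]) auto
    then have "bounded n"
      unfolding bounded_def using I(1,3)
      by (intro exI[of _ "I - {i\<in>I. length (M i) = Suc n}"] exI[of _ M]) (auto simp: le_Suc_eq)
    then have "Suc n \<le> n" using Least_le[of bounded n] n by simp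
    then show False by simp
  qed
  with I show ?thesis by blast
qed

section \<open>Additive solutions are elementary operators\<close>

lemma card_insert_set_le: "card (insert v (set w)) \<le> Suc (length w)"
  using card_length[of "v # w"] by simp

context infinite_over_center
begin

text \<open>
  With \<open>n > m + 1\<close> variables, a word of length at most \<open>m\<close> and one argument of \<open>f\<close> cannot
  involve all of them, so the polarized left-hand side is empty. A word of length at most \<open>n\<close>
  involving all \<open>n\<close> variables is an arrangement of them, so the right-hand side is the polarized
  leading form, which does not vanish identically.
\<close>

lemma additive_solution_degree_bound:
  fixes f :: "'a \<Rightarrow> 'a" and M N :: "nat \<Rightarrow> 'a list"
  assumes "additive f" "finite I" "finite J"
    and eq: "\<And>x. gpoly_eval (\<Sum>i\<in>I. gmonom (M i)) x * f x = gpoly_eval (\<Sum>j\<in>J. gmonom (N j)) x"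
    and M: "\<And>i. i \<in> I \<Longrightarrow> M i \<noteq> [] \<and> length (M i) \<le> Suc m"
    and N: "\<And>j. j \<in> J \<Longrightarrow> N j \<noteq> [] \<and> length (N j) \<le> Suc n"
    and lead: "(\<Sum>j\<in>{j\<in>J. length (N j) = Suc n}. gmonom (N j)) \<noteq> 0"
  shows "n \<le> Suc m"
proof (rule ccontr)
  assume "\<not> n \<le> Suc m"
  define V where "V = {..<n}"
  have V: "finite V" "card V = n" by (simp_all add: V_def)
  have empty: "{(i, w, v)\<in>(SIGMA i:I. words V (length (M i) - 1) \<times> V). insert v (set w) = V} = {}"
  proof -
    have "insert v (set w) \<noteq> V" if "i \<in> I" "w \<in> words V (length (M i) - 1)" for i w v
    proof
      assume "insert v (set w) = V"
      then have "n \<le> Suc (length w)" using card_insert_set_le[of v w] V by simp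
      moreover have "length w = length (M i) - 1" using that(2) by (simp add: words_def)
      moreover have "length (M i) \<le> Suc m" using M[OF that(1)] by blast
      ultimately show False using \<open>\<not> n \<le> Suc m\<close> by linarith
    qed
    then show ?thesis by blast
  qed
  have arrangements: "{(j, w)\<in>(SIGMA j:J. words V (length (N j) - 1)). set w = V}
      = {j\<in>J. length (N j) = Suc n} \<times> permutations_of_set V"
  proof -
    have "(j, w) \<in> (SIGMA j:J. words V (length (N j) - 1)) \<and> set w = V
        \<longleftrightarrow> (j, w) \<in> {j\<in>J. length (N j) = Suc n} \<times> permutations_of_set V" (is "?lhs \<longleftrightarrow> ?rhs") for j w
    proof
      assume ?lhs
      then have j: "j \<in> J" and len: "length w = length (N j) - 1" and w: "set w = V"
        by (auto simp only: words_def mem_Sigma_iff mem_Collect_eq)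
      have "n \<le> length w" using card_length[of w] unfolding w V .
      moreover have "0 < length (N j)" "length (N j) \<le> Suc n" using N[OF j] by auto
      ultimately have "length w = n" "length (N j) = Suc n" using len by linarith+
      moreover have "distinct w" using \<open>length w = n\<close> V(2) w by (intro card_distinct) simp
      ultimately show ?rhs using j w by (simp add: permutations_of_set_def)
    next
      assume ?rhs
      then have j: "j \<in> J" "length (N j) = Suc n" and w: "set w = V" "distinct w"
        by (auto simp only: permutations_of_set_def mem_Sigma_iff mem_Collect_eq)
      have "length w = n" using distinct_card[OF w(2)] unfolding w V ..
      with j w show ?lhs by (simp add: words_def)
    qed
    then show ?thesis by (intro set_eqI) (simp only: split_paired_all mem_Collect_eq prod.case)
  qed
  have "(\<Sum>j\<in>{j\<in>J. length (N j) = Suc n}. \<Sum>w\<in>permutations_of_set V. word_eval (N j) w y) = 0" for y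
    using polarized_identity[OF assms(2,3) V(1) assms(1) eq, of y] unfolding empty arrangements
    by (simp only: sum.cartesian_product sum.empty)
  moreover have "\<exists>y. (\<Sum>j\<in>{j\<in>J. length (N j) = Suc n}. \<Sum>w\<in>permutations_of_set V. word_eval (N j) w y) \<noteq> 0"
    by (rule polarization_nonzero[OF _ V(1) _ lead]) (use assms(3) V in simp_all)
  ultimately show False by blast
qed

text \<open>
  The degree bounds leave no room for repeated letters: in the variables \<open>0, \<dots>, m\<close> every surviving
  word is distinct, and on the left it avoids the letter \<open>v\<close> fed to \<open>f\<close>. Variable \<open>0\<close> is kept
  free, and the others are given values at which the polarized leading form does not vanish.
\<close>

lemma additive_solution_elementary:
  fixes f :: "'a \<Rightarrow> 'a" and M N :: "nat \<Rightarrow> 'a list"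
  assumes "additive f" "finite I" "finite J"
    and eq: "\<And>x. gpoly_eval (\<Sum>i\<in>I. gmonom (M i)) x * f x = gpoly_eval (\<Sum>j\<in>J. gmonom (N j)) x"
    and M: "\<And>i. i \<in> I \<Longrightarrow> M i \<noteq> [] \<and> length (M i) \<le> Suc m"
    and lead: "(\<Sum>i\<in>{i\<in>I. length (M i) = Suc m}. gmonom (M i)) \<noteq> 0"
    and N: "\<And>j. j \<in> J \<Longrightarrow> N j \<noteq> [] \<and> length (N j) \<le> Suc (Suc m)"
  shows "elementary_operator f"
proof -
  define V where "V = {..m}"
  define I' where "I' = {i\<in>I. length (M i) = Suc m}"
  have V: "finite V" "finite (V - {0})" "card V = Suc m" "card (V - {0}) = m"
    by (simp_all add: V_def)
  have "\<exists>y. (\<Sum>i\<in>I'. \<Sum>w\<in>permutations_of_set (V - {0}). word_eval (M i) w y) \<noteq> 0"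
    by (rule polarization_nonzero) (use V lead assms(2) in \<open>simp_all add: I'_def\<close>)
  then obtain y where y: "(\<Sum>i\<in>I'. \<Sum>w\<in>permutations_of_set (V - {0}). word_eval (M i) w y) \<noteq> 0" (is "?g \<noteq> 0")
    by blast
  define L where "L = {(i, w, v)\<in>(SIGMA i:I. words V (length (M i) - 1) \<times> V). insert v (set w) = V}"
  define R where "R = {(j, w)\<in>(SIGMA j:J. words V (length (N j) - 1)). set w = V}"
  define L\<^sub>0 where "L\<^sub>0 = (\<lambda>(i, w). (i, w, 0::nat)) ` (I' \<times> permutations_of_set (V - {0}))"
  have finL: "finite L"
    by (rule finite_subset[of _ "SIGMA i:I. words V (length (M i) - 1) \<times> V"])
      (use V assms(2) in \<open>auto simp: L_def finite_words\<close>)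
  have finR: "finite R"
    by (rule finite_subset[of _ "SIGMA j:J. words V (length (N j) - 1)"])
      (use V assms(3) in \<open>auto simp: R_def finite_words\<close>)
  have L: "i \<in> I' \<and> distinct w \<and> v \<notin> set w \<and> insert v (set w) = V" if "(i, w, v) \<in> L" for i w v
  proof -
    have i: "i \<in> I" "length w = length (M i) - 1" and eqV: "insert v (set w) = V"
      using that by (auto simp: L_def words_def)
    have "Suc m \<le> card (insert v (set w))" using eqV V by simp
    also have "\<dots> \<le> Suc (card (set w))" by (simp add: card_insert_if)
    finally have "m \<le> card (set w)" by simp
    moreover have "card (set w) \<le> length w" by (rule card_length)
    moreover have "length (M i) > 0" "length (M i) \<le> Suc m" using M[OF i(1)] by auto
    ultimately have *: "card (set w) = m" "length w = m" "length (M i) = Suc m"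
      using i(2) by linarith+
    moreover have "v \<notin> set w"
    proof
      assume "v \<in> set w"
      then have "card V = m" using eqV * by (simp add: insert_absorb)
      then show False using V by simp
    qed
    ultimately show ?thesis using card_distinct[of w] i(1) eqV by (simp add: I'_def)
  qed
  have R: "distinct w \<and> set w = V" if "(j, w) \<in> R" for j w
  proof -
    have j: "j \<in> J" "length w = length (N j) - 1" "set w = V"
      using that by (auto simp: R_def words_def)
    have "length w \<le> Suc m" using N[OF j(1)] j(2) by auto
    moreover have "Suc m \<le> length w" using card_length[of w] j(3) V by simp
    ultimately show ?thesis using card_distinct[of w] j(3) V by simp
  qed
  have L0_sub: "L\<^sub>0 \<subseteq> L"
  proof -
    have "length w = m" if "distinct w" "set w = V - {0}" for w
      using distinct_card[OF that(1)] that(2) V by simp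
    moreover have "insert 0 (V - {0}) = V" "0 \<in> V" by (auto simp: V_def)
    ultimately show ?thesis
      by (auto simp: L\<^sub>0_def L_def I'_def permutations_of_set_def words_def)
  qed
  have L0: "v \<noteq> 0" if "(i, w, v) \<in> L - L\<^sub>0" for i w v
  proof
    assume "v = 0"
    then have "i \<in> I'" "distinct w" "set w = V - {0}" using L[of i w v] that by auto
    then have "(i, w, v) \<in> L\<^sub>0" using \<open>v = 0\<close> by (auto simp: L\<^sub>0_def permutations_of_set_def)
    then show False using that by simp
  qed
  \<comment> \<open>\<open>L\<^sub>0\<close> collects the terms whose argument of \<open>f\<close> is the free variable. The factor \<open>1\<close> in \<open>A\<close>
      only gives its terms the same shape as those of \<open>B\<close>.\<close>
  define A where "A x = (\<Sum>s\<in>R. word_eval (N (fst s)) (snd s) (y(0 := x)) * 1)" for x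
  define B where "B x = (\<Sum>s\<in>L - L\<^sub>0. word_eval (M (fst s)) (fst (snd s)) (y(0 := x)) * f (y (snd (snd s))))" for x
  have "?g * f x = A x - B x" for x
  proof -
    have eqLR: "(\<Sum>(i, w, v)\<in>L. word_eval (M i) w (y(0 := x)) * f ((y(0 := x)) v))
        = (\<Sum>(j, w)\<in>R. word_eval (N j) w (y(0 := x)))"
      unfolding L_def R_def by (rule polarized_identity[OF assms(2,3) V(1) assms(1) eq])
    have eqA: "(\<Sum>(j, w)\<in>R. word_eval (N j) w (y(0 := x))) = A x"
      by (simp add: A_def case_prod_unfold)
    have eqL: "(\<Sum>(i, w, v)\<in>L. word_eval (M i) w (y(0 := x)) * f ((y(0 := x)) v))
        = (\<Sum>(i, w, v)\<in>L - L\<^sub>0. word_eval (M i) w (y(0 := x)) * f ((y(0 := x)) v))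
        + (\<Sum>(i, w, v)\<in>L\<^sub>0. word_eval (M i) w (y(0 := x)) * f ((y(0 := x)) v))"
      by (rule sum.subset_diff[OF L0_sub finL])
    have eqB: "(\<Sum>(i, w, v)\<in>L - L\<^sub>0. word_eval (M i) w (y(0 := x)) * f ((y(0 := x)) v)) = B x"
      unfolding B_def
    proof (rule sum.cong, goal_cases)
      case (2 s)
      then show ?case
        using L0[of "fst s" "fst (snd s)" "snd (snd s)"] by (simp add: case_prod_unfold)
    qed simp
    have eqg: "(\<Sum>(i, w, v)\<in>L\<^sub>0. word_eval (M i) w (y(0 := x)) * f ((y(0 := x)) v)) = ?g * f x"
    proof -
      have "(\<Sum>(i, w, v)\<in>L\<^sub>0. word_eval (M i) w (y(0 := x)) * f ((y(0 := x)) v))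
          = (\<Sum>(i, w)\<in>I' \<times> permutations_of_set (V - {0}). word_eval (M i) w (y(0 := x)) * f x)"
        unfolding L\<^sub>0_def by (subst sum.reindex) (simp_all add: inj_on_def case_prod_unfold)
      also have "\<dots> = (\<Sum>(i, w)\<in>I' \<times> permutations_of_set (V - {0}). word_eval (M i) w y * f x)"
      proof (rule sum.cong)
        fix s assume "s \<in> I' \<times> permutations_of_set (V - {0})"
        then have "set (snd s) = V - {0}"
          using permutations_of_setD(1) mem_Times_iff by metis
        then have "word_eval (M (fst s)) (snd s) (y(0 := x)) = word_eval (M (fst s)) (snd s) y"
          by (intro word_eval_cong) simp
        then show "(case s of (i, w) \<Rightarrow> word_eval (M i) w (y(0 := x)) * f x)
            = (case s of (i, w) \<Rightarrow> word_eval (M i) w y * f x)"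
          by (simp only: case_prod_unfold)
      qed simp
      also have "\<dots> = ?g * f x"
        unfolding sum_distrib_right by (rule sum.cartesian_product[symmetric])
      finally show ?thesis .
    qed
    have "A x = B x + ?g * f x"
      using eqLR unfolding eqA eqL eqB eqg by (rule HOL.sym)
    then show ?thesis by simp
  qed
  then have "inverse ?g * (A x - B x) = inverse ?g * (?g * f x)" for x
    by (simp only:)
  then have "inverse ?g * (A x - B x) = f x" for x
    by (simp only: mult.assoc[symmetric] left_inverse[OF y] mult_1_left)
  then have f: "f = (\<lambda>x. inverse ?g * (A x - B x))"
    by (intro ext) (rule HOL.sym)
  have "0 \<in> V" by (simp add: V_def)
  have "elementary_operator A"
    unfolding A_def
  proof (rule elementary_operator_sum[OF finR])
    fix s assume "s \<in> R"
    then show "elementary_operator (\<lambda>x. word_eval (N (fst s)) (snd s) (y(0 := x)) * 1)"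
      using R[of "fst s" "snd s"] \<open>0 \<in> V\<close> by (intro elementary_operator_word_eval) auto
  qed
  moreover have "elementary_operator B"
    unfolding B_def
  proof (rule elementary_operator_sum)
    show "finite (L - L\<^sub>0)" using finL by simp
    fix s assume s: "s \<in> L - L\<^sub>0"
    obtain i w v where s_eq: "s = (i, w, v)" by (cases s) auto
    have "distinct w" "0 \<in> set w"
      using L[of i w v] L0[of i w v] s \<open>0 \<in> V\<close> unfolding s_eq by auto
    then show "elementary_operator (\<lambda>x. word_eval (M (fst s)) (fst (snd s)) (y(0 := x)) * f (y (snd (snd s))))"
      unfolding s_eq fst_conv snd_conv by (rule elementary_operator_word_eval)
  qed
  ultimately show ?thesis
    unfolding f by (intro elementary_operator_mult_left elementary_operator_diff)
qed

end

lemma finite_dimensional_if_finite_span: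
  assumes "finite S" "cs.span S = (UNIV :: 'a::division_ring set)"
  shows "\<exists>B :: 'a set. finite_dimensional_vector_space center_scale B"
proof -
  obtain B where B: "B \<subseteq> S" "cs.independent B" "S \<subseteq> cs.span B"
    using cs.maximal_independent_subset by blast
  have "cs.span B = UNIV"
    using B(3) assms(2) cs.span_mono[OF B(3)] by (simp add: cs.span_span top.extremum_uniqueI)
  moreover have "finite B" using B(1) assms(1) finite_subset by blast
  ultimately have "finite_dimensional_vector_space center_scale B"
    using B(2) by unfold_locales auto
  then show ?thesis by blast
qed

theorem theoremA:
  fixes f :: "'a::division_ring \<Rightarrow> 'a" and G H :: "'a gpoly"
  assumes "additive f"
    and "\<forall>x. gpoly_eval G x * f x = gpoly_eval H x"
    and "G \<noteq> 0"
  shows "(\<exists>B :: 'a set. finite_dimensional_vector_space center_scale B) \<or> elementary_operator f"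
proof (cases "\<exists>S :: 'a set. finite S \<and> cs.span S = UNIV")
  case True
  then show ?thesis using finite_dimensional_if_finite_span by blast
next
  case False
  then interpret infinite_over_center "TYPE('a)"
    by unfold_locales blast
  obtain m and I :: "nat set" and M where I: "finite I" and G: "G = (\<Sum>i\<in>I. gmonom (M i))"
    and M: "\<forall>i\<in>I. M i \<noteq> [] \<and> length (M i) \<le> Suc m"
    and lead: "(\<Sum>i\<in>{i\<in>I. length (M i) = Suc m}. gmonom (M i)) \<noteq> 0"
    using gpoly_leading_form[OF assms(3)] by (elim exE conjE) (rule that)
  obtain J :: "nat set" and N where J: "finite J" and H: "H = (\<Sum>j\<in>J. gmonom (N j))"
    and N: "\<And>j. j \<in> J \<Longrightarrow> N j \<noteq> [] \<and> length (N j) \<le> Suc (Suc m)"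
  proof (cases "H = 0")
    case True
    then show ?thesis using that[of "{}"] by simp
  next
    case False
    obtain n and J :: "nat set" and N where J: "finite J" "H = (\<Sum>j\<in>J. gmonom (N j))"
      "\<forall>j\<in>J. N j \<noteq> [] \<and> length (N j) \<le> Suc n"
      "(\<Sum>j\<in>{j\<in>J. length (N j) = Suc n}. gmonom (N j)) \<noteq> 0"
      using gpoly_leading_form[OF False] by (elim exE conjE) (rule that)
    have "n \<le> Suc m"
      by (rule additive_solution_degree_bound[OF assms(1) I J(1) _ M[rule_format] J(3)[rule_format] J(4)])
        (use assms(2) in \<open>simp_all add: G J(2)\<close>)
    then show ?thesis using that[OF J(1,2)] J(3) by (meson Suc_le_mono order.trans)
  qed
  have "elementary_operator f"
    by (rule additive_solution_elementary[OF assms(1) I J _ M[rule_format] lead N])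
      (use assms(2) in \<open>simp_all add: G H\<close>)
  then show ?thesis ..
qed

end
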